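(* Let $G=(V,E)$ be an infinite, connected, locally finite graph with a specified vertex $o\in V$, and let $\{X_t\}_{t\ge0}$ denote simple random walk on $G$ started from $X_0=o$, with $t$-step transition probabilities $p_t(\cdot,\cdot)$. Assume that: (1) simple random walk on $G$ has positive asymptotic speed, $\boldsymbol{\ell}>0$; (2) simple random walk on $G$ has positive Avez entropy, $\boldsymbol{h}>0$; (3) $\lim_{t\to\infty}\frac1t\log p_t(o,X_t)=-\boldsymbol{h}$ almost surely. Let $p\in(0,1)$ be constant. Then the minimum number of toppling moves needed to transport mass $p$ to distance at least $n$ from $o$, starting from the unit mass $\delta_o$, is $$N_p(G,B_n,\delta_o)=\exp\Bigl(n\cdot\frac{\boldsymbol{h}}{\boldsymbol{\ell}}\,(1+o(1))\Bigr)\quad\text{as }n\to\infty,$$ that is, $\lim_{n\to\infty}\frac1n\log N_p(G,B_n,\delta_o)=\boldsymbol{h}/\boldsymbol{\ell}$.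
   Context: Speed: $\boldsymbol{\ell}=\lim_{t\to\infty}\frac{d(X_0,X_t)}{t}$, an almost sure limit that is a deterministic constant; $d$ is the graph distance. Entropy: for a discrete random variable $X$, $H(X)=-\sum_x\mathbb{P}(X=x)\log\mathbb{P}(X=x)$ (natural logarithm). The Avez (asymptotic) entropy of the walk is $\boldsymbol{h}=\lim_{t\to\infty}\frac{H(X_t)}{t}$, provided this limit exists. Assumptions (1) and (2) include the existence of these limits. Toppling: write $y\sim v$ when $y,v$ are adjacent and $\mathcal{N}_v=\{y:y\sim v\}$. A mass distribution is a function $\mu:V\to[0,\infty)$. For a vertex $v$ with $\mu(v)>0$ and $0<m\le\mu(v)$, the toppling move $T_v^m$ topples mass $m$ at $v$ equally to its neighbours: $T_v^m\mu=\mu-m\delta_v+\frac{m}{|\mathcal{N}_v|}\sum_{y\sim v}\delta_y$. For $A\subset V$, $p>0$ and an initial mass distribution $\mu_0$, $N_p(G,A,\mu_0)$ is the minimum number of successive toppling moves needed to obtain from $\mu_0$ a mass distribution $\mu$ with $\sum_{v\notin A}\mu(v)\ge p$ (and $\infty$ if this is impossible). $B_n=\{u\in V: d(u,o)<n\}$ is the open ball of radius $n$ around $o$ in the graph distance. *)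

theory Defs
  imports "HOL-Probability.Probability"
begin

text \<open>
  A graph is a vertex set \<open>V\<close> with an adjacency predicate \<open>E\<close>; graphs are simple and undirected.
\<close>

definition simple_graph :: "'a set \<Rightarrow> ('a \<Rightarrow> 'a \<Rightarrow> bool) \<Rightarrow> bool" where
  "simple_graph V E \<longleftrightarrow> (\<forall>x y. E x y \<longrightarrow> x \<in> V \<and> y \<in> V) \<and> symp E \<and> irreflp E"

definition connected_graph :: "'a set \<Rightarrow> ('a \<Rightarrow> 'a \<Rightarrow> bool) \<Rightarrow> bool" where
  "connected_graph V E \<longleftrightarrow> (\<forall>x\<in>V. \<forall>y\<in>V. E\<^sup>*\<^sup>* x y)"

definition nbrs :: "('a \<Rightarrow> 'a \<Rightarrow> bool) \<Rightarrow> 'a \<Rightarrow> 'a set" where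
  "nbrs E v = {y. E v y}"

definition locally_finite_graph :: "'a set \<Rightarrow> ('a \<Rightarrow> 'a \<Rightarrow> bool) \<Rightarrow> bool" where
  "locally_finite_graph V E \<longleftrightarrow> (\<forall>v\<in>V. finite (nbrs E v))"

text \<open>
  The length of a shortest path; only meaningful for vertices in the same component.
\<close>
definition graph_dist :: "('a \<Rightarrow> 'a \<Rightarrow> bool) \<Rightarrow> 'a \<Rightarrow> 'a \<Rightarrow> nat" where
  "graph_dist E x y = (LEAST n. (E ^^ n) x y)"

definition graph_ball :: "'a set \<Rightarrow> ('a \<Rightarrow> 'a \<Rightarrow> bool) \<Rightarrow> 'a \<Rightarrow> nat \<Rightarrow> 'a set" where
  "graph_ball V E v n = {u \<in> V. graph_dist E u v < n}"


text \<open>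
  \<open>pmf_of_set\<close> is the uniform distribution only on finite nonempty sets. In an infinite,
  connected, locally finite graph every neighbourhood is of this kind.
\<close>
definition srw_step :: "('a \<Rightarrow> 'a \<Rightarrow> bool) \<Rightarrow> 'a \<Rightarrow> 'a pmf" where
  "srw_step E x = pmf_of_set (nbrs E x)"

primrec srw_pmf :: "('a \<Rightarrow> 'a \<Rightarrow> bool) \<Rightarrow> nat \<Rightarrow> 'a \<Rightarrow> 'a pmf" where
  "srw_pmf E 0 x = return_pmf x"
| "srw_pmf E (Suc t) x = bind_pmf (srw_pmf E t x) (srw_step E)"

definition srw_prob :: "('a \<Rightarrow> 'a \<Rightarrow> bool) \<Rightarrow> nat \<Rightarrow> 'a \<Rightarrow> 'a \<Rightarrow> real" where
  "srw_prob E t x y = pmf (srw_pmf E t x) y"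

text \<open>
  The process \<open>X\<close> on \<open>M\<close> is a simple random walk started at \<open>v0\<close>, i.e. the Markov chain with
  this initial state and kernel \<open>srw_step\<close>, given by its finite-dimensional distributions.
\<close>
definition simple_random_walk ::
  "'a set \<Rightarrow> ('a \<Rightarrow> 'a \<Rightarrow> bool) \<Rightarrow> 'a \<Rightarrow> 'w measure \<Rightarrow> (nat \<Rightarrow> 'w \<Rightarrow> 'a) \<Rightarrow> bool" where
  "simple_random_walk V E v0 M X \<longleftrightarrow>
     prob_space M \<and>
     (\<forall>t. X t \<in> measurable M (count_space V)) \<and>
     (\<forall>t. \<forall>x :: nat \<Rightarrow> 'a.
        measure M {\<omega> \<in> space M. \<forall>i\<le>t. X i \<omega> = x i} =
          (if x 0 = v0 then \<Prod>i<t. pmf (srw_step E (x i)) (x (Suc i)) else 0))"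

text \<open>
  The value is the Shannon entropy whenever the series converges, in particular for random
  variables with finitely many values of positive probability. Note \<open>ln 0 = 0\<close>.
\<close>
definition shannon_entropy :: "'w measure \<Rightarrow> ('w \<Rightarrow> 'a) \<Rightarrow> real" where
  "shannon_entropy M Y =
     - (\<Sum>\<^sub>\<infinity>x. measure M {\<omega> \<in> space M. Y \<omega> = x} * ln (measure M {\<omega> \<in> space M. Y \<omega> = x}))"


definition topple :: "('a \<Rightarrow> 'a \<Rightarrow> bool) \<Rightarrow> 'a \<Rightarrow> real \<Rightarrow> ('a \<Rightarrow> real) \<Rightarrow> ('a \<Rightarrow> real)" where
  "topple E v m \<mu> = (\<lambda>x. \<mu> x - m * indicator {v} x
                          + m / real (card (nbrs E v)) * indicator (nbrs E v) x)"

definition topple_move ::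
  "'a set \<Rightarrow> ('a \<Rightarrow> 'a \<Rightarrow> bool) \<Rightarrow> ('a \<Rightarrow> real) \<Rightarrow> ('a \<Rightarrow> real) \<Rightarrow> bool" where
  "topple_move V E \<mu> \<mu>' \<longleftrightarrow> (\<exists>v\<in>V. \<exists>m. 0 < m \<and> m \<le> \<mu> v \<and> \<mu>' = topple E v m \<mu>)"

text \<open>
  The infimum is over a set of natural numbers, so it is attained unless the set is empty, in
  which case it is \<open>\<infinity>\<close>. The mass outside \<open>A\<close> is summed in \<open>ennreal\<close> since a general mass
  distribution may have infinite total mass.
\<close>
definition toppling_number ::
  "'a set \<Rightarrow> ('a \<Rightarrow> 'a \<Rightarrow> bool) \<Rightarrow> real \<Rightarrow> 'a set \<Rightarrow> ('a \<Rightarrow> real) \<Rightarrow> enat" where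
  "toppling_number V E p A \<mu>0 =
     Inf {enat k | k. \<exists>\<mu>. (topple_move V E ^^ k) \<mu>0 \<mu> \<and>
                          (\<Sum>\<^sub>\<infinity>v\<in>V - A. ennreal (\<mu> v)) \<ge> ennreal p}"

end

theory Submission
  imports Defs "HOL-Real_Asymp.Real_Asymp"
begin

text \<open>
  Both bounds compare toppling with the walk itself. For the upper bound, at each time \<open>t < T\<close>, with
  \<open>T\<close> slightly larger than \<open>n / l\<close>, one topples only the vertices \<open>x\<close> with
  \<open>p\<^sub>t(o, x) \<ge> exp (- (h + \<epsilon>) t) / C\<close>, of which there are at most \<open>C exp ((h + \<epsilon>) t)\<close>. The walk stays in
  these sets for all times with probability close to 1, and then it is outside the ball at time \<open>T\<close>.

  For the lower bound, let \<open>D\<close> be the set of all toppled vertices. The pairing of the mass with a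
  function that is superharmonic on \<open>D\<close> and equal to 1 outside the ball never increases. A suitable
  such function shows that, with probability at least \<open>p\<close>, the walk either leaves the ball before
  time \<open>T\<close> or is in \<open>D\<close> at time \<open>T\<close>. For \<open>T\<close> slightly smaller than \<open>n / l\<close> the former is unlikely, while
  \<open>X\<^sub>T\<close> is spread so thinly that the latter forces \<open>D\<close> to have about \<open>exp (h T)\<close> elements.
\<close>

section \<open>Toppling\<close>

locale infinite_graph =
  fixes V :: "'a set" and E :: "'a \<Rightarrow> 'a \<Rightarrow> bool"
  assumes graph: "simple_graph V E" "infinite V" "connected_graph V E" "locally_finite_graph V E"
begin

abbreviation step_prob :: "'a \<Rightarrow> 'a \<Rightarrow> real" where
  "step_prob v y \<equiv> pmf (srw_step E v) y"

section \<open>Neighbourhoods, the one-step kernel and graph distance\<close>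

lemma finite_nbrs: "v \<in> V \<Longrightarrow> finite (nbrs E v)"
  using graph(4) by (auto simp: locally_finite_graph_def)

lemma nbrs_subset: "nbrs E v \<subseteq> V"
  using graph(1) by (auto simp: nbrs_def simple_graph_def)

lemma nbrs_nonempty:
  assumes "v \<in> V" shows "nbrs E v \<noteq> {}"
proof -
  obtain w where w: "w \<in> V" "w \<noteq> v"
    using graph(2) assms by (metis finite.emptyI finite.insertI finite_subset insertI1 subsetI)
  have "E\<^sup>*\<^sup>* v w" using graph(3) assms w by (auto simp: connected_graph_def)
  then show ?thesis using w(2) by (cases rule: converse_rtranclpE) (auto simp: nbrs_def)
qed

lemma step_prob_eq: "v \<in> V \<Longrightarrow> step_prob v y = indicator (nbrs E v) y / card (nbrs E v)"
  unfolding srw_step_def by (rule pmf_of_set[OF nbrs_nonempty finite_nbrs])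

lemma topple_eq: "v \<in> V \<Longrightarrow> topple E v m \<mu> x = \<mu> x - m * indicator {v} x + m * step_prob v x"
  by (simp add: topple_def step_prob_eq)

lemma step_prob_outside: "v \<in> V \<Longrightarrow> y \<notin> nbrs E v \<Longrightarrow> step_prob v y = 0"
  by (simp add: step_prob_eq)

lemma sum_step_prob:
  assumes "v \<in> V" "finite F" "nbrs E v \<subseteq> F"
  shows "(\<Sum>y\<in>F. step_prob v y) = 1"
proof -
  have "set_pmf (srw_step E v) \<subseteq> F"
    unfolding srw_step_def using set_pmf_of_set[OF nbrs_nonempty finite_nbrs] assms by auto
  then show ?thesis using assms(2) by (rule sum_pmf_eq_1[rotated])
qed

text \<open>Local finiteness leaves finitely many vertices at each number of steps, and
  connectedness makes these exhaust \<open>V\<close>. Events can therefore be split by position, or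
  by path, using countable additivity.\<close>

lemma countable_V: "countable V"
proof (cases "V = {}")
  case False
  then obtain v where v: "v \<in> V" by auto
  have fin: "finite {y. (E ^^ n) v y}" for n
  proof (induction n)
    case (Suc n)
    have "{y. (E ^^ Suc n) v y} \<subseteq> (\<Union>z\<in>{y. (E ^^ n) v y} \<inter> V. nbrs E z)"
      using graph(1) by (auto simp: nbrs_def simple_graph_def)
    then show ?case by (rule finite_subset) (use Suc finite_nbrs in auto)
  qed simp
  have "V \<subseteq> (\<Union>n. {y. (E ^^ n) v y})"
    using graph(3) v by (auto simp: connected_graph_def rtranclp_power)
  moreover have "countable (\<Union>n. {y. (E ^^ n) v y})"
    using fin by (intro countable_UN) (auto intro: countable_finite)
  ultimately show ?thesis by (rule countable_subset)
qed auto

text \<open>Walks in an undirected graph can be reversed. This reconciles the ball, which uses the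
  distance to its centre, with the speed, which uses the distance from the start.\<close>

lemma graph_dist_commute: "graph_dist E x y = graph_dist E y x"
proof -
  have sym: "(E ^^ n) x y" if "(E ^^ n) y x" for n x y
    using that
  proof (induction n arbitrary: x)
    case (Suc n)
    then obtain z where z: "(E ^^ n) y z" "E z x" by auto
    then have "E x z" using graph(1) by (auto simp: simple_graph_def dest: sympD)
    then show ?case using Suc.IH[OF z(1)] by (rule relpowp_Suc_I2)
  qed auto
  then have "(E ^^ n) x y = (E ^^ n) y x" for n by blast
  then show ?thesis by (simp add: graph_dist_def)
qed

text \<open>Repeated topplings at one vertex enlarge \<open>D\<close> only once, so
  \<open>card D\<close> bounds the number of moves from below. A lower bound for the moves thus
  reduces to one for the number of toppled vertices.\<close>

lemma relpowp_topple_subset: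
  assumes "(topple_move V E ^^ k) \<mu> \<mu>'"
  shows "\<exists>D\<subseteq>V. finite D \<and> card D \<le> k \<and> (topple_move D E ^^ k) \<mu> \<mu>'"
  using assms
proof (induction k arbitrary: \<mu>')
  case 0
  then show ?case by (intro exI[of _ "{}"]) auto
next
  case (Suc k)
  then obtain \<nu> where \<nu>: "(topple_move V E ^^ k) \<mu> \<nu>" "topple_move V E \<nu> \<mu>'" by auto
  from Suc.IH[OF \<nu>(1)] obtain D
    where D: "D \<subseteq> V" "finite D" "card D \<le> k" "(topple_move D E ^^ k) \<mu> \<nu>" by auto
  from \<nu>(2) obtain v where v: "v \<in> V" "topple_move {v} E \<nu> \<mu>'" by (auto simp: topple_move_def)
  have mono: "topple_move D' E \<le> topple_move (insert v D) E" if "D' \<subseteq> insert v D" for D'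
    using that unfolding topple_move_def by blast
  have "(topple_move (insert v D) E ^^ k) \<mu> \<nu>"
    using relpowp_mono[of "topple_move D E" "topple_move (insert v D) E"] mono[of D] D(4) by blast
  moreover have "topple_move (insert v D) E \<nu> \<mu>'" using mono[of "{v}"] v(2) by auto
  ultimately show ?case
    using D v(1) by (intro exI[of _ "insert v D"]) (auto simp: card_insert_if)
qed

text \<open>Toppling mass \<open>m\<close> at \<open>v\<close> lowers the pairing of mass and
  \<open>g\<close> by \<open>m\<close> times the excess of \<open>g v\<close> over its average on
  the neighbours. The finite set \<open>F\<close> holds all mass that can occur, so every sum is
  finite.\<close>

lemma relpowp_topple_superharmonic:
  fixes g :: "'a \<Rightarrow> real"
  assumes "(topple_move D E ^^ k) \<mu> \<mu>'" and D: "D \<subseteq> V"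
    and F: "finite F" "D \<subseteq> F" "\<And>v. v \<in> D \<Longrightarrow> nbrs E v \<subseteq> F"
    and \<mu>: "\<And>x. 0 \<le> \<mu> x" "\<And>x. x \<notin> F \<Longrightarrow> \<mu> x = 0"
    and g: "\<And>v. v \<in> D \<Longrightarrow> (\<Sum>y\<in>F. step_prob v y * g y) \<le> g v"
  shows "(\<forall>x. 0 \<le> \<mu>' x) \<and> (\<forall>x. x \<notin> F \<longrightarrow> \<mu>' x = 0) \<and>
    (\<Sum>x\<in>F. \<mu>' x * g x) \<le> (\<Sum>x\<in>F. \<mu> x * g x)"
  using assms(1)
proof (induction k arbitrary: \<mu>')
  case 0
  then show ?case using \<mu> by auto
next
  case (Suc k)
  then obtain \<nu> where \<nu>: "(topple_move D E ^^ k) \<mu> \<nu>" "topple_move D E \<nu> \<mu>'" by auto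
  then obtain v m where v: "v \<in> D" "0 < m" "m \<le> \<nu> v" "\<mu>' = topple E v m \<nu>"
    by (auto simp: topple_move_def)
  have \<mu>': "\<mu>' x = \<nu> x - m * indicator {v} x + m * step_prob v x" for x
    using topple_eq v D by auto
  note IH = Suc.IH[OF \<nu>(1)]
  have "0 \<le> \<mu>' x" for x
    unfolding \<mu>' using IH v by (auto simp: indicator_def)
  moreover have "\<mu>' x = 0" if "x \<notin> F" for x
    unfolding \<mu>' using IH v F D that step_prob_outside[of v x] by (auto simp: indicator_def)
  moreover have "(\<Sum>x\<in>F. \<mu>' x * g x) =
      (\<Sum>x\<in>F. \<nu> x * g x) - m * (g v - (\<Sum>y\<in>F. step_prob v y * g y))"
  proof -
    have "(\<Sum>x\<in>F. indicator {v} x * g x) = g v"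
      using F v(1) by (subst sum.remove[of _ v]) (auto intro!: sum.neutral)
    then have "(\<Sum>x\<in>F. m * (indicator {v} x * g x)) = m * g v"
      by (simp flip: sum_distrib_left)
    moreover have "(\<Sum>x\<in>F. m * (step_prob v x * g x)) = m * (\<Sum>y\<in>F. step_prob v y * g y)"
      by (simp flip: sum_distrib_left)
    ultimately show ?thesis
      unfolding \<mu>' by (simp add: ring_distribs sum.distrib sum_subtractf mult.assoc)
  qed
  moreover have "0 \<le> m * (g v - (\<Sum>y\<in>F. step_prob v y * g y))"
    using g[OF v(1)] v(2) by simp
  ultimately show ?case using IH by auto
qed

text \<open>
  Abandoned mass stays put, so only the mass \<open>m v\<close> out of \<open>\<mu> v\<close> is toppled.
\<close>
lemma topple_finite_set:
  assumes "finite S" "S \<subseteq> V" "\<And>v. v \<in> S \<Longrightarrow> 0 \<le> m v" "\<And>v. v \<in> S \<Longrightarrow> m v \<le> \<mu> v"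
  shows "\<exists>k\<le>card S. \<exists>\<mu>'. (topple_move V E ^^ k) \<mu> \<mu>' \<and>
    (\<forall>x. \<mu>' x = \<mu> x - m x * indicator S x + (\<Sum>v\<in>S. m v * step_prob v x))"
  using assms
proof (induction S rule: finite_induct)
  case empty
  then show ?case by (intro exI[of _ 0]) auto
next
  case (insert v S)
  then obtain k \<nu> where k: "k \<le> card S" and \<nu>: "(topple_move V E ^^ k) \<mu> \<nu>"
    "\<And>x. \<nu> x = \<mu> x - m x * indicator S x + (\<Sum>v\<in>S. m v * step_prob v x)" by auto
  \<comment> \<open>A move must topple a positive mass, so a vertex with nothing to topple is
    skipped.\<close>
  show ?case
  proof (cases "m v = 0")
    case True
    have "\<nu> x = \<mu> x - m x * indicator (insert v S) x + (\<Sum>v\<in>insert v S. m v * step_prob v x)" for x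
      using insert True unfolding \<nu>(2) by (auto simp: indicator_def)
    then show ?thesis using k \<nu>(1) insert
      by (intro exI[of _ k]) (auto intro!: exI[of _ \<nu>])
  next
    case False
    let ?\<nu> = "topple E v (m v) \<nu>"
    \<comment> \<open>As \<open>v\<close> is not in \<open>S\<close>, earlier moves have only added
      mass at \<open>v\<close>, so \<open>m v\<close> is still available there.\<close>
    have "0 \<le> (\<Sum>w\<in>S. m w * step_prob w v)"
      using insert by (intro sum_nonneg) auto
    then have "m v \<le> \<nu> v"
      using insert.prems(3)[of v] insert.hyps(2) unfolding \<nu>(2) by simp
    moreover have "0 < m v" using insert False by (simp add: order_less_le)
    ultimately have "topple_move V E \<nu> ?\<nu>" using insert by (auto simp: topple_move_def)
    then have "(topple_move V E ^^ Suc k) \<mu> ?\<nu>" using \<nu>(1) by auto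
    moreover have "?\<nu> x = \<mu> x - m x * indicator (insert v S) x + (\<Sum>v\<in>insert v S. m v * step_prob v x)" for x
      using insert by (subst topple_eq) (auto simp: \<nu>(2) indicator_def)
    ultimately show ?thesis using k insert
      by (intro exI[of _ "Suc k"]) (auto intro!: exI[of _ ?\<nu>])
  qed
qed

text \<open>Think of \<open>q t\<close> as the mass still being carried at time \<open>t\<close>.
  The invariant is that the actual mass dominates it pointwise; round \<open>t\<close> then topples
  exactly \<open>q t\<close> on \<open>S t\<close>, in at most \<open>card (S t)\<close> moves, and
  the rest is abandoned where it lies.\<close>

lemma topple_along_sets:
  assumes S: "\<And>t. finite (S t)" "\<And>t. S t \<subseteq> V"
    and q0: "\<And>x. 0 \<le> q 0 x" "\<And>x. q 0 x \<le> \<mu> x"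
    and q: "\<And>t x. q (Suc t) x = (\<Sum>v\<in>S t. q t v * step_prob v x)"
  shows "\<exists>k\<le>(\<Sum>t<T. card (S t)). \<exists>\<mu>'. (topple_move V E ^^ k) \<mu> \<mu>' \<and> (\<forall>x. q T x \<le> \<mu>' x)"
proof (induction T)
  case 0
  show ?case using q0 by (intro exI[of _ 0]) auto
next
  case (Suc T)
  then obtain k \<nu> where k: "k \<le> (\<Sum>t<T. card (S t))" and \<nu>: "(topple_move V E ^^ k) \<mu> \<nu>"
    "\<And>x. q T x \<le> \<nu> x" by auto
  have qn: "0 \<le> q t x" for t x
    by (induction t arbitrary: x) (auto simp: q q0 intro!: sum_nonneg)
  from topple_finite_set[of "S T" "q T" \<nu>] S \<nu>(2) qn
  obtain j \<mu>' where j: "j \<le> card (S T)" and \<mu>': "(topple_move V E ^^ j) \<nu> \<mu>'"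
    "\<And>x. \<mu>' x = \<nu> x - q T x * indicator (S T) x + (\<Sum>v\<in>S T. q T v * step_prob v x)"
    by auto
  have "(topple_move V E ^^ (k + j)) \<mu> \<mu>'"
    using \<nu>(1) \<mu>'(1) by (auto simp: relpowp_add)
  moreover have "q (Suc T) x \<le> \<mu>' x" for x
    using \<nu>(2)[of x] qn[of T x] by (auto simp: \<mu>'(2) q indicator_def)
  ultimately show ?case using k j
    by (intro exI[of _ "k + j"]) auto
qed

text \<open>It suffices to bound the mass from below on a finite part \<open>W\<close> of the
  complement of \<open>A\<close>, where the \<open>ennreal\<close> series becomes a finite real
  sum.\<close>

lemma toppling_number_leI:
  assumes "(topple_move V E ^^ k) \<mu>0 \<mu>" "finite W" "W \<subseteq> V - A"
    and "p \<le> (\<Sum>v\<in>W. q v)" "\<And>v. v \<in> W \<Longrightarrow> 0 \<le> q v" "\<And>v. v \<in> W \<Longrightarrow> q v \<le> \<mu> v"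
  shows "toppling_number V E p A \<mu>0 \<le> enat k"
proof -
  have "ennreal p \<le> ennreal (\<Sum>v\<in>W. q v)" using assms(4) by (rule ennreal_leI)
  also have "\<dots> = (\<Sum>v\<in>W. ennreal (q v))" using assms(5) by (simp add: sum_ennreal)
  also have "\<dots> \<le> (\<Sum>v\<in>W. ennreal (\<mu> v))" using assms(6) by (intro sum_mono ennreal_leI)
  also have "\<dots> = (\<Sum>\<^sub>\<infinity>v\<in>W. ennreal (\<mu> v))" using assms(2) by simp
  also have "\<dots> \<le> (\<Sum>\<^sub>\<infinity>v\<in>V - A. ennreal (\<mu> v))"
    using assms(3) by (intro infsum_mono_neutral nonneg_summable_on_complete) auto
  finally show ?thesis
    unfolding toppling_number_def using assms(1) by (intro Inf_lower) auto
qed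

text \<open>
  The probability that the walk from \<open>x\<close> either leaves \<open>B\<close> within \<open>j\<close> steps, through vertices of
  \<open>D\<close> only, or stays in \<open>D\<close> throughout. Unlike the exit probability itself it decreases in \<open>j\<close>,
  which makes it superharmonic on \<open>D\<close> for each fixed \<open>j\<close>.
\<close>
primrec escape :: "'a set \<Rightarrow> 'a set \<Rightarrow> nat \<Rightarrow> 'a \<Rightarrow> real" where
  "escape B D 0 x = (if x \<in> B \<and> x \<notin> D then 0 else 1)"
| "escape B D (Suc j) x = (if x \<in> B then if x \<in> D
     then \<Sum>y\<in>nbrs E x. step_prob x y * escape B D j y else 0 else 1)"

lemma escape_nonneg: "0 \<le> escape B D j x"
  by (induction j arbitrary: x) (auto intro!: sum_nonneg)

lemma escape_outside: "x \<notin> B \<Longrightarrow> escape B D j x = 1"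
  by (cases j) auto

lemma escape_le_1:
  assumes "D \<subseteq> V" shows "escape B D j x \<le> 1"
proof (induction j arbitrary: x)
  case (Suc j)
  have "(\<Sum>y\<in>nbrs E x. step_prob x y * escape B D j y) \<le> (\<Sum>y\<in>nbrs E x. step_prob x y)" 
    using Suc by (intro sum_mono mult_left_le) auto
  moreover have "(\<Sum>y\<in>nbrs E x. step_prob x y) = 1" if "x \<in> D"
    using that assms sum_step_prob[of x "nbrs E x"] finite_nbrs by auto
  ultimately show ?case by auto
qed auto

text \<open>At \<open>j = 0\<close> the value is 1 wherever it is not forced to be 0 for every
  \<open>j\<close>, so the first step cannot raise it, and averaging over neighbours preserves the
  inequality.\<close>

lemma escape_antimono:
  assumes "D \<subseteq> V" shows "escape B D (Suc j) x \<le> escape B D j x"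
proof (induction j arbitrary: x)
  case 0
  show ?case using escape_le_1[OF assms, of B "Suc 0" x] by (auto simp del: escape.simps(2)) simp
next
  case (Suc j)
  then show ?case
    by (subst (1 2) escape.simps) (auto simp del: escape.simps intro!: sum_mono mult_left_mono)
qed

text \<open>Inside \<open>B\<close> the average over the neighbours is the value for
  \<open>Suc j\<close>, at most that for \<open>j\<close>; outside \<open>B\<close> the value is 1,
  the maximum.\<close>

lemma escape_superharmonic:
  assumes "D \<subseteq> V" "v \<in> D"
  shows "(\<Sum>y\<in>nbrs E v. step_prob v y * escape B D j y) \<le> escape B D j v"
proof (cases "v \<in> B")
  case True
  then show ?thesis using escape_antimono[OF assms(1), of B j v] assms(2) by simp
next
  case False
  have "(\<Sum>y\<in>nbrs E v. step_prob v y * escape B D j y) \<le> (\<Sum>y\<in>nbrs E v. step_prob v y)"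
    using escape_le_1[OF assms(1)] by (intro sum_mono mult_left_le) auto
  then show ?thesis
    using False sum_step_prob[of v "nbrs E v"] finite_nbrs assms by (auto simp: escape_outside)
qed

lemma sum_nbrs_extend:
  assumes "v \<in> V" "finite F" "nbrs E v \<subseteq> F"
  shows "(\<Sum>y\<in>F. step_prob v y * g y) = (\<Sum>y\<in>nbrs E v. step_prob v y * g y)"
  using assms step_prob_outside by (intro sum.mono_neutral_right) auto

text \<open>Mass outside \<open>B\<close> has weight 1 in the pairing with \<open>escape\<close>,
  and the pairing starts at \<open>escape B D j v0\<close>. The set \<open>D\<close> is obtained
  before \<open>j\<close>, so the horizon can be chosen afterwards.\<close>

lemma toppled_mass_le_escape:
  assumes "v0 \<in> V" "(topple_move V E ^^ k) (indicator {v0}) \<mu>"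
    and "ennreal p \<le> (\<Sum>\<^sub>\<infinity>v\<in>V - B. ennreal (\<mu> v))"
  obtains D where "D \<subseteq> V" "finite D" "card D \<le> k" "\<And>j. p \<le> escape B D j v0"
proof -
  from relpowp_topple_subset[OF assms(2)] obtain D
    where D: "D \<subseteq> V" "finite D" "card D \<le> k" "(topple_move D E ^^ k) (indicator {v0}) \<mu>" by auto
  \<comment> \<open>The initial mass lies in \<open>F\<close>, and no toppling at a vertex of
    \<open>D\<close> can push mass out of it.\<close>
  define F where "F = insert v0 (D \<union> (\<Union>v\<in>D. nbrs E v))"
  have F: "finite F" "D \<subseteq> F" "\<And>v. v \<in> D \<Longrightarrow> nbrs E v \<subseteq> F" "v0 \<in> F" "F \<subseteq> V"
    using D finite_nbrs nbrs_subset assms(1) by (auto simp: F_def)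
  have "p \<le> escape B D j v0" for j
  proof -
    have *: "(\<forall>x. 0 \<le> \<mu> x) \<and> (\<forall>x. x \<notin> F \<longrightarrow> \<mu> x = 0) \<and>
      (\<Sum>x\<in>F. \<mu> x * escape B D j x) \<le> (\<Sum>x\<in>F. indicator {v0} x * escape B D j x)"
    proof (rule relpowp_topple_superharmonic[OF D(4,1) F(1,2,3)])
      fix v assume "v \<in> D"
      then show "(\<Sum>y\<in>F. step_prob v y * escape B D j y) \<le> escape B D j v"
        using escape_superharmonic[OF D(1)] sum_nbrs_extend[of v F] D(1) F by auto
    qed (use F in \<open>auto simp: indicator_def\<close>)
    have "(\<Sum>\<^sub>\<infinity>v\<in>V - B. ennreal (\<mu> v)) = (\<Sum>\<^sub>\<infinity>v\<in>F - B. ennreal (\<mu> v))"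
      using * F(5) by (intro infsum_cong_neutral) auto
    then have "ennreal p \<le> (\<Sum>\<^sub>\<infinity>v\<in>F - B. ennreal (\<mu> v))" using assms(3) by simp
    also have "\<dots> = ennreal (\<Sum>v\<in>F - B. \<mu> v)" using F(1) * by (simp add: sum_ennreal)
    finally have "p \<le> (\<Sum>v\<in>F - B. \<mu> v)"
      using * by (subst (asm) ennreal_le_iff) (auto intro: sum_nonneg)
    also have "\<dots> = (\<Sum>v\<in>F - B. \<mu> v * escape B D j v)" by (simp add: escape_outside)
    also have "\<dots> \<le> (\<Sum>v\<in>F. \<mu> v * escape B D j v)"
      using F(1) * escape_nonneg by (intro sum_mono2) auto
    also have "\<dots> \<le> (\<Sum>x\<in>F. indicator {v0} x * escape B D j x)" using * by auto
    also have "\<dots> = escape B D j v0"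
      using F by (subst sum.remove[of _ v0]) (auto intro!: sum.neutral)
    finally show ?thesis .
  qed
  with D show ?thesis by (intro that) auto
qed

end

section \<open>Probabilistic estimates\<close>

text \<open>Convergence gives the bound for large \<open>t\<close>; the finitely many earlier values
  are absorbed into \<open>K\<close>. Taking \<open>K\<close> natural leads to countably many events
  in the probabilistic version.\<close>

lemma eventually_linear_bound:
  fixes f :: "nat \<Rightarrow> real"
  assumes "(\<lambda>t. f t / real t) \<longlonglongrightarrow> c" "\<epsilon> > 0"
  shows "\<exists>K::nat. \<forall>t. f t \<le> real K + (c + \<epsilon>) * real t"
proof -
  have "\<forall>\<^sub>F t in sequentially. f t / real t < c + \<epsilon>"
    using assms by (intro order_tendstoD) auto
  then obtain t0 where t0: "\<And>t. t \<ge> t0 \<Longrightarrow> f t / real t < c + \<epsilon>"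
    by (auto simp: eventually_sequentially)
  define g where "g t = f t - (c + \<epsilon>) * real t" for t
  obtain K :: nat where K: "(\<Sum>t\<le>t0. \<bar>g t\<bar>) \<le> real K" using real_arch_simple by blast
  have "f t \<le> real K + (c + \<epsilon>) * real t" for t
  proof (cases "t \<le> t0")
    case True
    then have "\<bar>g t\<bar> \<le> (\<Sum>t\<le>t0. \<bar>g t\<bar>)" by (intro member_le_sum) auto
    then show ?thesis using K by (auto simp: g_def)
  next
    case False
    then have "f t < (c + \<epsilon>) * real t" using t0[of t] by (simp add: pos_divide_less_eq)
    then show ?thesis by (rule order.trans[OF less_imp_le]) simp
  qed
  then show ?thesis by blast
qed

text \<open>An almost sure limit becomes a bound valid at all times simultaneously, off an event of
  small probability: the events \<open>A K\<close> increase with \<open>K\<close>, and their union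
  has probability 1.\<close>

lemma (in prob_space) prob_linear_bound:
  fixes f :: "nat \<Rightarrow> 'a \<Rightarrow> real"
  assumes [measurable]: "\<And>t. f t \<in> borel_measurable M"
    and "AE \<omega> in M. (\<lambda>t. f t \<omega> / real t) \<longlonglongrightarrow> c" "\<epsilon> > 0" "\<delta> > 0"
  shows "\<exists>K::nat. prob {\<omega>\<in>space M. \<forall>t. f t \<omega> \<le> real K + (c + \<epsilon>) * real t} \<ge> 1 - \<delta>"
proof -
  define A where "A K = {\<omega>\<in>space M. \<forall>t. f t \<omega> \<le> real K + (c + \<epsilon>) * real t}" for K :: nat
  have [measurable]: "A K \<in> events" for K unfolding A_def by measurable
  have "AE \<omega> in M. \<omega> \<in> (\<Union>K. A K)"
    using assms(2) AE_space
  proof eventually_elim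
    case (elim \<omega>)
    then show ?case using eventually_linear_bound[OF _ assms(3)] by (auto simp: A_def)
  qed
  then have "prob (\<Union>K. A K) = 1" by (subst prob_eq_1) auto
  moreover have "(\<lambda>K. prob (A K)) \<longlonglongrightarrow> prob (\<Union>K. A K)"
  proof (rule finite_Lim_measure_incseq)
    show "incseq A"
      unfolding A_def by (auto simp: incseq_def intro: order.trans)
  qed auto
  ultimately have "\<forall>\<^sub>F K in sequentially. 1 - \<delta> < prob (A K)"
    using assms(4) by (intro order_tendstoD) auto
  then show ?thesis unfolding A_def by (auto simp: eventually_sequentially intro: less_imp_le)
qed

lemma (in prob_space) prob_inter_ge:
  assumes "A \<in> events" "B \<in> events"
  shows "prob (A \<inter> B) \<ge> prob A + prob B - 1"
proof -
  have "prob (A \<union> B) = prob A + prob B - prob (A \<inter> B)"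
    using assms by (intro measure_Un3) (auto simp: fmeasurable_eq_sets)
  then show ?thesis using prob_le_1[of "A \<union> B"] by linarith
qed

text \<open>Each point of the level set has mass at least \<open>c\<close>, and the total mass is 1.
  Since this bounds all finite subsets uniformly, the level set is itself finite.\<close>

lemma pmf_level_set:
  assumes "c > 0"
  shows "finite {x. c \<le> pmf P x}" "real (card {x. c \<le> pmf P x}) \<le> 1 / c"
proof -
  have *: "real (card W) \<le> 1 / c" if "finite W" "W \<subseteq> {x. c \<le> pmf P x}" for W
  proof -
    have "real (card W) * c \<le> (\<Sum>x\<in>W. pmf P x)"
      using that(2) by (intro sum_bounded_below) auto
    also have "\<dots> = measure P W" using that(1) by (simp add: measure_measure_pmf_finite)
    also have "\<dots> \<le> 1" by (rule measure_pmf.prob_le_1)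
    finally show ?thesis using assms by (simp add: pos_le_divide_eq)
  qed
  have "card W \<le> nat \<lfloor>1 / c\<rfloor>" if "finite W" "W \<subseteq> {x. c \<le> pmf P x}" for W
    using *[OF that] assms by (simp add: le_nat_floor)
  then show "finite {x. c \<le> pmf P x}"
    using finite_if_finite_subsets_card_bdd[of "{x. c \<le> pmf P x}" "nat \<lfloor>1 / c\<rfloor>"] by blast
  with * show "real (card {x. c \<le> pmf P x}) \<le> 1 / c" by simp
qed

section \<open>The walk killed outside prescribed sets\<close>

locale graph_walk = infinite_graph V E + prob_space M
  for V :: "'a set" and E :: "'a \<Rightarrow> 'a \<Rightarrow> bool" and M :: "'w measure" +
  fixes v0 :: 'a and X :: "nat \<Rightarrow> 'w \<Rightarrow> 'a"
  assumes origin: "v0 \<in> V" and walk: "simple_random_walk V E v0 M X"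
begin

section \<open>Path probabilities and the Markov property\<close>

lemma measurable_X: "X t \<in> measurable M (count_space V)"
  using walk by (auto simp: simple_random_walk_def)

lemma X_in_V: "\<omega> \<in> space M \<Longrightarrow> X t \<omega> \<in> V"
  using measurable_space[OF measurable_X] by simp

lemma measurable_pred_X [measurable]: "Measurable.pred M (\<lambda>\<omega>. P (X t \<omega>))"
  by (rule measurable_compose[OF measurable_X]) simp

lemma measurable_fun_X [measurable]: "(\<lambda>\<omega>. (g (X t \<omega>) :: real)) \<in> borel_measurable M"
  by (rule measurable_compose[OF measurable_X]) simp

lemma prob_cylinder:
  "prob {\<omega>\<in>space M. \<forall>i\<le>t. X i \<omega> = x i} =
     (if x 0 = v0 then \<Prod>i<t. step_prob (x i) (x (Suc i)) else 0)"
  using walk by (auto simp: simple_random_walk_def)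

lemma prob_cylinder_Suc:
  "prob {\<omega>\<in>space M. (\<forall>i\<le>t. X i \<omega> = x i) \<and> X (Suc t) \<omega> = y} =
     prob {\<omega>\<in>space M. \<forall>i\<le>t. X i \<omega> = x i} * step_prob (x t) y"
proof -
  let ?x = "x(Suc t := y)"
  have "{\<omega>\<in>space M. (\<forall>i\<le>t. X i \<omega> = x i) \<and> X (Suc t) \<omega> = y} =
      {\<omega>\<in>space M. \<forall>i\<le>Suc t. X i \<omega> = ?x i}"
    by (auto simp: le_Suc_eq)
  moreover have "(\<Prod>i<t. step_prob (?x i) (?x (Suc i))) = (\<Prod>i<t. step_prob (x i) (x (Suc i)))"
    by (intro prod.cong) auto
  ultimately show ?thesis by (simp add: prob_cylinder)
qed

text \<open>An unnormalised law. The strict inequality leaves the position at time \<open>t\<close>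
  free, so mass that has just stepped out of the prescribed sets is still seen.\<close>

definition killed :: "(nat \<Rightarrow> 'a set) \<Rightarrow> nat \<Rightarrow> 'a \<Rightarrow> real" where
  "killed S t v = prob {\<omega>\<in>space M. (\<forall>s<t. X s \<omega> \<in> S s) \<and> X t \<omega> = v}"

lemma killed_nonneg: "0 \<le> killed S t v"
  by (simp add: killed_def)

text \<open>The walk is given through cylinder probabilities, so the event is cut into the cylinders
  of its paths; each gains the factor \<open>step_prob v y\<close>, the same for all paths ending at
  \<open>v\<close>.\<close>

lemma markov:
  "emeasure M {\<omega>\<in>space M. ((\<forall>s<t. X s \<omega> \<in> S s) \<and> X t \<omega> = v) \<and> X (Suc t) \<omega> = y} =
     ennreal (killed S t v * step_prob v y)"
proof -
  \<comment> \<open>Functions in \<open>PiE\<close> are determined by their values up to time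
    \<open>t\<close>; this makes \<open>F\<close> countable and the cylinders of distinct members
    disjoint.\<close>
  define F where "F = {x \<in> PiE {..t} (\<lambda>_. V). (\<forall>s<t. x s \<in> S s) \<and> x t = v}"
  have F: "countable F"
    unfolding F_def using countable_V
    by (intro countable_subset[OF _ countable_PiE[of "{..t}" "\<lambda>_. V"]]) auto
  have path: "\<exists>x\<in>F. \<forall>i\<le>t. X i \<omega> = x i"
    if "\<omega> \<in> space M" "\<forall>s<t. X s \<omega> \<in> S s" "X t \<omega> = v" for \<omega>
    using that X_in_V by (intro bexI[of _ "restrict (\<lambda>i. X i \<omega>) {..t}"]) (auto simp: F_def)
  \<comment> \<open>The event \<open>Q\<close> will be the next position and, to recover
    \<open>killed\<close> itself, the sure event.\<close>
  have union: "emeasure M {\<omega>\<in>space M. ((\<forall>s<t. X s \<omega> \<in> S s) \<and> X t \<omega> = v) \<and> Q \<omega>} =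
     (\<integral>\<^sup>+x. emeasure M {\<omega>\<in>space M. (\<forall>i\<le>t. X i \<omega> = x i) \<and> Q \<omega>} \<partial>count_space F)"
    if [measurable]: "Measurable.pred M Q" for Q
  proof -
    have "{\<omega>\<in>space M. ((\<forall>s<t. X s \<omega> \<in> S s) \<and> X t \<omega> = v) \<and> Q \<omega>} =
        (\<Union>x\<in>F. {\<omega>\<in>space M. (\<forall>i\<le>t. X i \<omega> = x i) \<and> Q \<omega>})"
      using path by (auto simp: F_def)
    also have "emeasure M \<dots> =
        (\<integral>\<^sup>+x. emeasure M {\<omega>\<in>space M. (\<forall>i\<le>t. X i \<omega> = x i) \<and> Q \<omega>} \<partial>count_space F)"
    proof (rule emeasure_UN_countable[OF _ F])
      show "disjoint_family_on (\<lambda>x. {\<omega>\<in>space M. (\<forall>i\<le>t. X i \<omega> = x i) \<and> Q \<omega>}) F"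
        unfolding disjoint_family_on_def
      proof (intro ballI impI)
        fix x x' assume "x \<in> F" "x' \<in> F" "x \<noteq> x'"
        then have "\<exists>i\<le>t. x i \<noteq> x' i"
          using PiE_ext[of x "{..t}" "\<lambda>_. V" x'] by (auto simp: F_def)
        then show "{\<omega>\<in>space M. (\<forall>i\<le>t. X i \<omega> = x i) \<and> Q \<omega>} \<inter>
            {\<omega>\<in>space M. (\<forall>i\<le>t. X i \<omega> = x' i) \<and> Q \<omega>} = {}" by auto
      qed
    qed measurable
    finally show ?thesis .
  qed
  have "emeasure M {\<omega>\<in>space M. ((\<forall>s<t. X s \<omega> \<in> S s) \<and> X t \<omega> = v) \<and> X (Suc t) \<omega> = y} =
      (\<integral>\<^sup>+x. emeasure M {\<omega>\<in>space M. \<forall>i\<le>t. X i \<omega> = x i} * ennreal (step_prob v y) \<partial>count_space F)"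
    by (subst union, measurable, intro nn_integral_cong) (auto simp: F_def emeasure_eq_measure prob_cylinder_Suc ennreal_mult)
  also have "\<dots> = (\<integral>\<^sup>+x. emeasure M {\<omega>\<in>space M. \<forall>i\<le>t. X i \<omega> = x i} \<partial>count_space F) *
      ennreal (step_prob v y)"
    by (intro nn_integral_multc) auto
  also have "(\<integral>\<^sup>+x. emeasure M {\<omega>\<in>space M. \<forall>i\<le>t. X i \<omega> = x i} \<partial>count_space F) =
      ennreal (killed S t v)"
    using union[of "\<lambda>_. True"] by (simp add: killed_def emeasure_eq_measure)
  finally show ?thesis by (simp add: ennreal_mult killed_nonneg)
qed

lemma emeasure_killed_in:
  "emeasure M {\<omega>\<in>space M. (\<forall>s<t. X s \<omega> \<in> S s) \<and> X t \<omega> \<in> A} =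
     (\<integral>\<^sup>+v. ennreal (killed S t v) \<partial>count_space (A \<inter> V))"
proof -
  have "{\<omega>\<in>space M. (\<forall>s<t. X s \<omega> \<in> S s) \<and> X t \<omega> \<in> A} =
      (\<Union>v\<in>A \<inter> V. {\<omega>\<in>space M. (\<forall>s<t. X s \<omega> \<in> S s) \<and> X t \<omega> = v})"
    using X_in_V by auto
  also have "emeasure M \<dots> =
      (\<integral>\<^sup>+v. emeasure M {\<omega>\<in>space M. (\<forall>s<t. X s \<omega> \<in> S s) \<and> X t \<omega> = v} \<partial>count_space (A \<inter> V))"
  proof (rule emeasure_UN_countable)
    show "countable (A \<inter> V)" using countable_V by auto
  qed (auto simp: disjoint_family_on_def)
  finally show ?thesis by (simp add: killed_def emeasure_eq_measure)
qed

text \<open>The forward equation, in \<open>ennreal\<close> so as to cover infinite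
  \<open>S t\<close>, in particular the unkilled walk with every \<open>S t\<close> equal to
  \<open>UNIV\<close>.\<close>

lemma killed_Suc_nn:
  "ennreal (killed S (Suc t) y) =
     (\<integral>\<^sup>+v. ennreal (killed S t v * step_prob v y) \<partial>count_space (S t \<inter> V))"
proof -
  have "{\<omega>\<in>space M. (\<forall>s<Suc t. X s \<omega> \<in> S s) \<and> X (Suc t) \<omega> = y} =
      (\<Union>v\<in>S t \<inter> V. {\<omega>\<in>space M. ((\<forall>s<t. X s \<omega> \<in> S s) \<and> X t \<omega> = v) \<and> X (Suc t) \<omega> = y})"
    using X_in_V by (auto simp: less_Suc_eq)
  also have "emeasure M \<dots> = (\<integral>\<^sup>+v. emeasure M
      {\<omega>\<in>space M. ((\<forall>s<t. X s \<omega> \<in> S s) \<and> X t \<omega> = v) \<and> X (Suc t) \<omega> = y} \<partial>count_space (S t \<inter> V))"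
  proof (rule emeasure_UN_countable)
    show "countable (S t \<inter> V)" using countable_V by auto
  qed (auto simp: disjoint_family_on_def)
  finally show ?thesis unfolding markov by (simp add: killed_def[of S "Suc t"] emeasure_eq_measure)
qed

text \<open>This is exactly the recursion asked of \<open>q\<close> in
  \<open>topple_along_sets\<close>: the mass carried by the topplings is the law of the killed
  walk.\<close>

lemma killed_Suc:
  assumes "finite (S t)" "S t \<subseteq> V"
  shows "killed S (Suc t) y = (\<Sum>v\<in>S t. killed S t v * step_prob v y)"
proof -
  have "ennreal (killed S (Suc t) y) = ennreal (\<Sum>v\<in>S t. killed S t v * step_prob v y)"
    using assms killed_nonneg
    by (simp add: killed_Suc_nn Int_absorb2 nn_integral_count_space_finite sum_ennreal)
  then show ?thesis
    by (subst (asm) ennreal_inj) (auto simp: killed_nonneg intro!: sum_nonneg)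
qed

text \<open>The target \<open>A\<close> may be infinite; a finite \<open>W\<close> carrying all the
  killed mass in \<open>A\<close> turns the probability into a finite sum.\<close>

lemma prob_killed_in:
  assumes "finite W" "W \<subseteq> A \<inter> V" "\<And>v. v \<in> A \<inter> V - W \<Longrightarrow> killed S t v = 0"
  shows "prob {\<omega>\<in>space M. (\<forall>s<t. X s \<omega> \<in> S s) \<and> X t \<omega> \<in> A} = (\<Sum>v\<in>W. killed S t v)"
proof -
  have "emeasure M {\<omega>\<in>space M. (\<forall>s<t. X s \<omega> \<in> S s) \<and> X t \<omega> \<in> A} = ennreal (\<Sum>v\<in>W. killed S t v)"
    unfolding emeasure_killed_in
    using assms by (subst nn_integral_count_space'[of W]) (auto simp: sum_ennreal killed_nonneg)
  then show ?thesis
    by (simp add: emeasure_eq_measure killed_nonneg sum_nonneg)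
qed

lemma killed_0: "killed S 0 v = indicator {v0} v"
  using prob_cylinder[of 0 "\<lambda>_. v"] by (simp add: killed_def indicator_def)

lemma AE_X_0: "AE \<omega> in M. X 0 \<omega> = v0"
proof -
  have "prob {\<omega>\<in>space M. X 0 \<omega> = v0} = 1" using killed_0[of _ v0] by (simp add: killed_def)
  then show ?thesis by (subst (asm) prob_Collect_eq_1) auto
qed

text \<open>With all sets equal to \<open>UNIV\<close> nothing is killed, and the forward equation
  coincides with the recursion of \<open>srw_pmf\<close>.\<close>

lemma prob_X: "prob {\<omega>\<in>space M. X t \<omega> = y} = srw_prob E t v0 y"
proof -
  have "killed (\<lambda>_. UNIV) t y = pmf (srw_pmf E t v0) y"
  proof (induction t arbitrary: y)
    case 0
    then show ?case by (simp add: killed_0 indicator_def pmf_return eq_commute)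
  next
    case (Suc t)
    \<comment> \<open>The bind in \<open>srw_pmf\<close> ranges over the whole type, the forward
      equation only over \<open>V\<close>.\<close>
    have out: "pmf (srw_pmf E t v0) v = 0" if "v \<notin> V" for v
    proof -
      have empty: "{\<omega>\<in>space M. X t \<omega> = v} = {}" using X_in_V that by auto
      have "killed (\<lambda>_. UNIV) t v = prob {\<omega>\<in>space M. X t \<omega> = v}" by (simp add: killed_def)
      then have "killed (\<lambda>_. UNIV) t v = 0" unfolding empty by simp
      then show ?thesis by (simp add: Suc)
    qed
    have "ennreal (pmf (srw_pmf E (Suc t) v0) y) =
        (\<integral>\<^sup>+v. ennreal (pmf (srw_pmf E t v0) v) * ennreal (step_prob v y) \<partial>count_space UNIV)"
      by (simp add: ennreal_pmf_bind nn_integral_measure_pmf)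
    also have "\<dots> = (\<integral>\<^sup>+v. ennreal (pmf (srw_pmf E t v0) v) * ennreal (step_prob v y) \<partial>count_space V)"
      using out by (intro nn_integral_count_space_eq) auto
    also have "\<dots> = ennreal (killed (\<lambda>_. UNIV) (Suc t) y)"
      by (simp add: killed_Suc_nn Suc ennreal_mult)
    finally show ?case by (simp add: killed_nonneg)
  qed
  then show ?thesis by (simp add: killed_def srw_prob_def)
qed

text \<open>The null vertices in \<open>V\<close> are countably many, so almost surely all are
  avoided. Positivity matters because \<open>ln 0 = 0\<close> would make a vanishing probability
  look like 1.\<close>

lemma AE_srw_prob_pos: "AE \<omega> in M. 0 < srw_prob E t v0 (X t \<omega>)"
proof -
  have "emeasure M {\<omega>\<in>space M. (\<forall>s<t. X s \<omega> \<in> UNIV) \<and> X t \<omega> \<in> {x. srw_prob E t v0 x = 0}} = 0"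
    by (subst emeasure_killed_in[of t "\<lambda>_. UNIV"])
       (auto simp: killed_def prob_X nn_integral_0_iff_AE AE_count_space)
  then have "AE \<omega> in M. \<not> srw_prob E t v0 (X t \<omega>) = 0"
    by (subst AE_iff_measurable[OF _ refl]) auto
  then show ?thesis by eventually_elim (simp add: srw_prob_def pmf_pos)
qed

text \<open>Follow the walk killed on leaving \<open>D \<inter> B\<close>. Mass leaving
  \<open>B\<close> is charged to the exit event, mass leaving \<open>D\<close> inside
  \<open>B\<close> has escape value 0, and what survives to time \<open>T\<close> lies in
  \<open>D\<close>.\<close>

lemma escape_le_prob:
  assumes D: "finite D" "D \<subseteq> V"
  shows "escape B D T v0 \<le> prob {\<omega>\<in>space M. X T \<omega> \<in> D} + prob {\<omega>\<in>space M. \<exists>s\<le>T. X s \<omega> \<notin> B}"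
proof -
  define S where "S = (\<lambda>_::nat. D \<inter> B)"
  have S: "finite (S t)" "S t \<subseteq> V" for t using D by (auto simp: S_def)
  define C where "C j = {\<omega>\<in>space M. \<exists>s\<le>j. X s \<omega> \<notin> B}" for j
  have [measurable]: "C j \<in> events" for j unfolding C_def by measurable
  \<comment> \<open>After \<open>j\<close> steps the surviving mass is weighted by the escape value
    for the remaining horizon, while \<open>prob (C j)\<close> accounts for the exits so
    far.\<close>
  have step: "escape B D T v0 \<le> (\<Sum>v\<in>D \<inter> B. killed S j v * escape B D (T - j) v) + prob (C j)"
    if "j \<le> T" for j
    using that
  proof (induction j)
    case 0
    have C0: "prob (C 0) = 1" if "v0 \<notin> B"
    proof -
      have "AE \<omega> in M. \<omega> \<in> C 0"
        using AE_X_0 AE_space by eventually_elim (use that in \<open>auto simp: C_def\<close>)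
      then show ?thesis by (subst prob_eq_1) auto
    qed
    consider "v0 \<notin> B" | "v0 \<in> D \<inter> B" | "v0 \<in> B" "v0 \<notin> D" by auto
    then show ?case
    proof cases
      case 1
      then show ?thesis using C0
        by (auto simp: escape_outside killed_nonneg escape_nonneg intro!: sum_nonneg)
    next
      case 2
      then have "killed S 0 v0 * escape B D T v0 \<le> (\<Sum>v\<in>D \<inter> B. killed S 0 v * escape B D T v)"
        using D by (intro member_le_sum) (auto simp: killed_nonneg escape_nonneg)
      then show ?thesis by (simp add: killed_0 add_increasing2)
    next
      case 3
      then have "escape B D T v0 = 0" by (cases T) auto
      then show ?thesis by (auto simp: killed_nonneg escape_nonneg intro!: add_nonneg_nonneg sum_nonneg)
    qed
  next
    case (Suc j)
    define Y where "Y = (\<Union>v\<in>D. nbrs E v)"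
    have Y: "finite Y" "Y \<subseteq> V" "\<And>v. v \<in> D \<Longrightarrow> nbrs E v \<subseteq> Y"
      using D finite_nbrs nbrs_subset by (auto simp: Y_def)
    let ?e = "escape B D (T - Suc j)"
    let ?k = "killed S (Suc j)"
    have TS: "T - j = Suc (T - Suc j)" using Suc.prems by auto
    have "(\<Sum>v\<in>D \<inter> B. killed S j v * escape B D (T - j) v) =
        (\<Sum>v\<in>D \<inter> B. \<Sum>y\<in>Y. killed S j v * step_prob v y * ?e y)"
    proof (rule sum.cong[OF refl])
      fix v assume v: "v \<in> D \<inter> B"
      then have "escape B D (T - j) v = (\<Sum>y\<in>Y. step_prob v y * ?e y)"
        using sum_nbrs_extend[of v Y ?e] D Y by (auto simp: TS)
      then show "killed S j v * escape B D (T - j) v = (\<Sum>y\<in>Y. killed S j v * step_prob v y * ?e y)"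
        by (simp add: sum_distrib_left mult.assoc)
    qed
    also have "\<dots> = (\<Sum>y\<in>Y. ?k y * ?e y)"
      using killed_Suc[of S j, OF S] by (subst sum.swap) (simp add: S_def sum_distrib_right)
    \<comment> \<open>Arrivals in \<open>D \<inter> B\<close> go on; among the others, those in
      \<open>B\<close> have weight 0 and those outside \<open>B\<close> weight 1.\<close>
    also have "\<dots> = (\<Sum>y\<in>Y \<inter> (D \<inter> B). ?k y * ?e y) + (\<Sum>y\<in>Y - D \<inter> B. ?k y * ?e y)"
      by (rule sum.Int_Diff[OF Y(1)])
    also have "(\<Sum>y\<in>Y \<inter> (D \<inter> B). ?k y * ?e y) \<le> (\<Sum>y\<in>D \<inter> B. ?k y * ?e y)"
      using D by (intro sum_mono2) (auto simp: killed_nonneg escape_nonneg)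
    also have "(\<Sum>y\<in>Y - D \<inter> B. ?k y * ?e y) = (\<Sum>y\<in>Y - B. ?k y)"
    proof (rule sum.mono_neutral_cong_right)
      show "\<forall>y\<in>Y - D \<inter> B - (Y - B). ?k y * ?e y = 0"
      proof
        fix y assume "y \<in> Y - D \<inter> B - (Y - B)"
        then have "?e y = 0" by (cases "T - Suc j") auto
        then show "?k y * ?e y = 0" by simp
      qed
    qed (use Y in \<open>auto simp: escape_outside\<close>)
    also have "\<dots> = prob {\<omega>\<in>space M. (\<forall>s<Suc j. X s \<omega> \<in> S s) \<and> X (Suc j) \<omega> \<in> Y - B}"
      using Y by (intro prob_killed_in[symmetric]) auto
    finally have "escape B D T v0 \<le> (\<Sum>y\<in>D \<inter> B. ?k y * ?e y) +
        (prob {\<omega>\<in>space M. (\<forall>s<Suc j. X s \<omega> \<in> S s) \<and> X (Suc j) \<omega> \<in> Y - B} + prob (C j))"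
      using Suc by simp
    \<comment> \<open>The two events are disjoint: staying in \<open>S\<close> up to time
      \<open>j\<close> excludes an exit from \<open>B\<close> by then.\<close>
    also have "prob {\<omega>\<in>space M. (\<forall>s<Suc j. X s \<omega> \<in> S s) \<and> X (Suc j) \<omega> \<in> Y - B} + prob (C j) =
        prob ({\<omega>\<in>space M. (\<forall>s<Suc j. X s \<omega> \<in> S s) \<and> X (Suc j) \<omega> \<in> Y - B} \<union> C j)"
      by (intro finite_measure_Union[symmetric]) (auto simp: C_def S_def less_Suc_eq_le)
    also have "\<dots> \<le> prob (C (Suc j))"
      by (intro finite_measure_mono) (auto simp: C_def le_Suc_eq)
    finally show ?case by simp
  qed
  have "(\<Sum>v\<in>D \<inter> B. killed S T v * escape B D (T - T) v) \<le> (\<Sum>v\<in>D. killed S T v)"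
    using D killed_nonneg by (subst (2) sum.Int_Diff[of _ _ B]) (auto intro!: sum_mono sum_nonneg add_increasing2)
  also have "\<dots> = prob {\<omega>\<in>space M. (\<forall>s<T. X s \<omega> \<in> S s) \<and> X T \<omega> \<in> D}"
    using D by (intro prob_killed_in[symmetric]) auto
  also have "\<dots> \<le> prob {\<omega>\<in>space M. X T \<omega> \<in> D}"
    by (intro finite_measure_mono) auto
  finally show ?thesis using step[of T] by (simp add: C_def)
qed

section \<open>Bounds on the toppling number\<close>

text \<open>Killing outside small level sets of the transition probabilities costs little mass, and
  toppling along these sets reproduces the killed law. The constants \<open>K\<close> and
  \<open>K'\<close> may depend on \<open>\<epsilon>\<close> but serve all \<open>n\<close> and
  \<open>T\<close>.\<close>

lemma toppling_number_upper:
  assumes speed: "AE \<omega> in M. (\<lambda>t. real (graph_dist E (X 0 \<omega>) (X t \<omega>)) / real t) \<longlonglongrightarrow> l"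
    and transition: "AE \<omega> in M. (\<lambda>t. ln (srw_prob E t v0 (X t \<omega>)) / real t) \<longlonglongrightarrow> - h"
    and p: "p < 1" and \<epsilon>: "0 < \<epsilon>" and h: "0 \<le> h + \<epsilon>"
  shows "\<exists>K K' :: nat. \<forall>n T. T > 0 \<longrightarrow> real n + real K' \<le> (l - \<epsilon>) * real T \<longrightarrow>
    (\<exists>k. toppling_number V E p (graph_ball V E v0 n) (indicator {v0}) \<le> enat k \<and>
      real k \<le> real T * exp (real K + (h + \<epsilon>) * real T))"
proof -
  define f where "f t \<omega> = - ln (srw_prob E t v0 (X t \<omega>))" for t \<omega>
  \<comment> \<open>The minus sign turns the upper bound of \<open>prob_linear_bound\<close> into a
    lower bound for the distance.\<close>
  define d where "d t \<omega> = - real (graph_dist E v0 (X t \<omega>))" for t \<omega>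
  have [measurable]: "f t \<in> borel_measurable M" "d t \<in> borel_measurable M" for t
    unfolding f_def d_def by measurable
  have "AE \<omega> in M. (\<lambda>t. f t \<omega> / real t) \<longlonglongrightarrow> h"
    using transition by eventually_elim (auto simp: f_def dest: tendsto_minus)
  \<comment> \<open>Each of the two bad events gets half of \<open>1 - p\<close>, which leaves
    probability at least \<open>p\<close>.\<close>
  from prob_linear_bound[OF _ this \<epsilon>, of "(1 - p) / 2"] p
  obtain K :: nat where K: "1 - (1 - p) / 2 \<le> prob {\<omega>\<in>space M. \<forall>t. f t \<omega> \<le> real K + (h + \<epsilon>) * real t}"
    by auto
  have "AE \<omega> in M. (\<lambda>t. d t \<omega> / real t) \<longlonglongrightarrow> - l"
    using speed AE_X_0 by eventually_elim (auto simp: d_def dest: tendsto_minus)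
  from prob_linear_bound[OF _ this \<epsilon>, of "(1 - p) / 2"] p
  obtain K' :: nat where K': "1 - (1 - p) / 2 \<le> prob {\<omega>\<in>space M. \<forall>t. d t \<omega> \<le> real K' + (- l + \<epsilon>) * real t}"
    by auto
  define G1 where "G1 = {\<omega>\<in>space M. \<forall>t. f t \<omega> \<le> real K + (h + \<epsilon>) * real t}"
  define G2 where "G2 = {\<omega>\<in>space M. \<forall>t. d t \<omega> \<le> real K' + (- l + \<epsilon>) * real t}"
  define G where "G = G1 \<inter> G2"
  have [measurable]: "G1 \<in> events" "G2 \<in> events" unfolding G1_def G2_def by measurable
  have G: "p \<le> prob G"
    using K[folded G1_def] K'[folded G2_def] prob_inter_ge[of G1 G2] by (simp add: G_def field_simps)
  have [measurable]: "G \<in> events" unfolding G_def by measurable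
  \<comment> \<open>Almost surely on \<open>G1\<close>, the bound on \<open>f\<close> says that the
    position at time \<open>t\<close> has probability at least \<open>c t\<close>.\<close>
  define c where "c t = exp (- real K - (h + \<epsilon>) * real t)" for t :: nat
  define S where "S t = V \<inter> {x. c t \<le> srw_prob E t v0 x}" for t
  have c_pos: "0 < c t" for t by (simp add: c_def)
  have S_fin: "finite (S t)" and S_sub: "S t \<subseteq> V" for t
    using pmf_level_set(1)[OF c_pos] by (auto simp: S_def srw_prob_def)
  have card_S: "real (card (S t)) \<le> exp (real K + (h + \<epsilon>) * real t)" for t
  proof -
    have "card (S t) \<le> card {x. c t \<le> pmf (srw_pmf E t v0) x}"
      using pmf_level_set(1)[OF c_pos] by (intro card_mono) (auto simp: S_def srw_prob_def)
    then have "real (card (S t)) \<le> 1 / c t"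
      using pmf_level_set(2)[OF c_pos, of t "srw_pmf E t v0"] by linarith
    also have "\<dots> = exp (real K + (h + \<epsilon>) * real t)"
      by (simp add: c_def exp_minus[symmetric] divide_inverse algebra_simps)
    finally show ?thesis .
  qed
  have "\<exists>k. toppling_number V E p (graph_ball V E v0 n) (indicator {v0}) \<le> enat k \<and>
      real k \<le> real T * exp (real K + (h + \<epsilon>) * real T)"
    if T: "T > 0" "real n + real K' \<le> (l - \<epsilon>) * real T" for n T
  proof -
    define B where "B = graph_ball V E v0 n"
    \<comment> \<open>A finite part of \<open>V - B\<close> holding everything that a step from the
      last toppled set can place outside \<open>B\<close>.\<close>
    define W where "W = (\<Union>v\<in>S (T - 1). nbrs E v) - B"
    have W: "finite W" "W \<subseteq> V - B"
      unfolding W_def using S_fin nbrs_subset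
      by (blast intro: finite_nbrs S_sub[THEN subsetD])+
    from topple_along_sets[of S "killed S" "indicator {v0}" T] S_fin S_sub
    obtain k \<mu> where k: "k \<le> (\<Sum>t<T. card (S t))"
      and \<mu>: "(topple_move V E ^^ k) (indicator {v0}) \<mu>" "\<And>x. killed S T x \<le> \<mu> x"
      by (auto simp: killed_0 killed_Suc)
    have "p \<le> prob G" by (rule G)
    also have "\<dots> \<le> prob {\<omega>\<in>space M. (\<forall>s<T. X s \<omega> \<in> S s) \<and> X T \<omega> \<in> V - B}"
    proof (rule finite_measure_mono_AE)
      have "AE \<omega> in M. \<forall>t. 0 < srw_prob E t v0 (X t \<omega>)"
        using AE_srw_prob_pos by (simp add: AE_all_countable)
      then show "AE \<omega> in M. \<omega> \<in> G \<longrightarrow> \<omega> \<in> {\<omega>\<in>space M. (\<forall>s<T. X s \<omega> \<in> S s) \<and> X T \<omega> \<in> V - B}"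
      proof eventually_elim
        case (elim \<omega>)
        show ?case
        proof
          assume \<omega>: "\<omega> \<in> G"
          have "X t \<omega> \<in> S t" for t
          proof -
            have "ln (c t) \<le> ln (srw_prob E t v0 (X t \<omega>))"
              using \<omega> by (auto simp: G_def G1_def G2_def f_def c_def algebra_simps dest!: spec[of _ t])
            then show ?thesis
              using elim c_pos X_in_V[of \<omega> t] \<omega> by (auto simp: S_def G_def G1_def G2_def)
          qed
          moreover have "real n \<le> real (graph_dist E v0 (X T \<omega>))"
          proof -
            have "d T \<omega> \<le> real K' + (- l + \<epsilon>) * real T" using \<omega> by (auto simp: G_def G1_def G2_def)
            then show ?thesis using T(2) by (simp add: d_def algebra_simps)
          qed
          ultimately show "\<omega> \<in> {\<omega>\<in>space M. (\<forall>s<T. X s \<omega> \<in> S s) \<and> X T \<omega> \<in> V - B}"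
            using \<omega> X_in_V[of \<omega> T] by (auto simp: B_def graph_ball_def G_def G1_def G2_def graph_dist_commute)
        qed
      qed
    qed measurable
    also have "\<dots> = (\<Sum>v\<in>W. killed S T v)"
    proof (rule prob_killed_in[OF W(1)])
      fix y assume y: "y \<in> (V - B) \<inter> V - W"
      have "killed S (Suc (T - 1)) y = 0"
        unfolding killed_Suc[of S "T - 1", OF S_fin S_sub]
        using y S_sub[THEN subsetD] step_prob_outside by (intro sum.neutral) (auto simp: W_def)
      then show "killed S T y = 0" using T(1) by simp
    qed (use W in auto)
    finally have "toppling_number V E p B (indicator {v0}) \<le> enat k"
      using toppling_number_leI[OF \<mu>(1) W(1), of B p "killed S T"] W(2) \<mu>(2) killed_nonneg by auto
    moreover have "real k \<le> real T * exp (real K + (h + \<epsilon>) * real T)"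
    proof -
      have "real k \<le> real (\<Sum>t<T. card (S t))" using k by (rule of_nat_mono)
      also have "\<dots> = (\<Sum>t<T. real (card (S t)))" by simp
      \<comment> \<open>As \<open>h + \<epsilon>\<close> is nonnegative, the estimate at
        \<open>T\<close> dominates those at all earlier times.\<close>
      also have "\<dots> \<le> (\<Sum>t<T. exp (real K + (h + \<epsilon>) * real T))"
        using h by (intro sum_mono order.trans[OF card_S]) (auto intro!: mult_left_mono)
      finally show ?thesis by simp
    qed
    ultimately show ?thesis unfolding B_def by blast
  qed
  then show ?thesis by blast
qed

text \<open>Of the probability \<open>p\<close> demanded, \<open>p / 4\<close> is given up for
  leaving the ball too early and \<open>p / 4\<close> for an unusually likely position at time
  \<open>T\<close>. The remaining \<open>p / 2\<close> must come from at most \<open>k\<close>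
  vertices of small probability each.\<close>

lemma toppling_number_lower:
  assumes speed: "AE \<omega> in M. (\<lambda>t. real (graph_dist E (X 0 \<omega>) (X t \<omega>)) / real t) \<longlonglongrightarrow> l"
    and transition: "AE \<omega> in M. (\<lambda>t. ln (srw_prob E t v0 (X t \<omega>)) / real t) \<longlonglongrightarrow> - h"
    and p: "0 < p" and \<epsilon>: "0 < \<epsilon>" and l: "0 \<le> l + \<epsilon>"
  shows "\<exists>K K' :: nat. \<forall>n T k. real K' + (l + \<epsilon>) * real T < real n \<longrightarrow>
    toppling_number V E p (graph_ball V E v0 n) (indicator {v0}) = enat k \<longrightarrow>
      p / 2 \<le> real k * exp (real K - (h - \<epsilon>) * real T)"
proof -
  define f where "f t \<omega> = ln (srw_prob E t v0 (X t \<omega>))" for t \<omega>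
  define d where "d t \<omega> = real (graph_dist E v0 (X t \<omega>))" for t \<omega>
  have [measurable]: "f t \<in> borel_measurable M" "d t \<in> borel_measurable M" for t
    unfolding f_def d_def by measurable
  have "AE \<omega> in M. (\<lambda>t. f t \<omega> / real t) \<longlonglongrightarrow> - h"
    using transition by (simp add: f_def)
  from prob_linear_bound[OF _ this \<epsilon>, of "p / 4"] p
  obtain K :: nat where K: "1 - p / 4 \<le> prob {\<omega>\<in>space M. \<forall>t. f t \<omega> \<le> real K + (- h + \<epsilon>) * real t}"
    by auto
  have "AE \<omega> in M. (\<lambda>t. d t \<omega> / real t) \<longlonglongrightarrow> l"
    using speed AE_X_0 by eventually_elim (auto simp: d_def)
  from prob_linear_bound[OF _ this \<epsilon>, of "p / 4"] p
  obtain K' :: nat where K': "1 - p / 4 \<le> prob {\<omega>\<in>space M. \<forall>t. d t \<omega> \<le> real K' + (l + \<epsilon>) * real t}"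
    by auto
  have "p / 2 \<le> real k * exp (real K - (h - \<epsilon>) * real T)"
    if T: "real K' + (l + \<epsilon>) * real T < real n"
      and k: "toppling_number V E p (graph_ball V E v0 n) (indicator {v0}) = enat k" for n T k
  proof -
    define B where "B = graph_ball V E v0 n"
    define A where "A = {enat k | k. \<exists>\<mu>. (topple_move V E ^^ k) (indicator {v0}) \<mu> \<and>
      (\<Sum>\<^sub>\<infinity>v\<in>V - B. ennreal (\<mu> v)) \<ge> ennreal p}"
    have "Inf A = enat k" using k by (simp add: A_def B_def toppling_number_def)
    \<comment> \<open>The infimum of the empty set is \<open>\<infinity>\<close>, so a finite value
      is attained and yields an actual toppling sequence.\<close>
    moreover from this have "A \<noteq> {}" by (auto simp: Inf_enat_def)
    ultimately have "enat k \<in> A" by (metis wellorder_InfI ex_in_conv)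
    then obtain \<mu> where \<mu>: "(topple_move V E ^^ k) (indicator {v0}) \<mu>"
      "ennreal p \<le> (\<Sum>\<^sub>\<infinity>v\<in>V - B. ennreal (\<mu> v))" by (auto simp: A_def)
    from toppled_mass_le_escape[OF origin \<mu>] obtain D
      where D: "D \<subseteq> V" "finite D" "card D \<le> k" "\<And>j. p \<le> escape B D j v0" by blast
    let ?b = "exp (real K - (h - \<epsilon>) * real T)"
    have "p \<le> prob {\<omega>\<in>space M. X T \<omega> \<in> D} + prob {\<omega>\<in>space M. \<exists>s\<le>T. X s \<omega> \<notin> B}"
      using D(4)[of T] escape_le_prob[OF D(2,1), of B T] by linarith
    moreover have "prob {\<omega>\<in>space M. \<exists>s\<le>T. X s \<omega> \<notin> B} \<le> p / 4"
    proof -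
      let ?G = "{\<omega>\<in>space M. \<forall>t. d t \<omega> \<le> real K' + (l + \<epsilon>) * real t}"
      have "prob {\<omega>\<in>space M. \<exists>s\<le>T. X s \<omega> \<notin> B} \<le> prob (space M - ?G)"
      proof (rule finite_measure_mono)
        show "{\<omega>\<in>space M. \<exists>s\<le>T. X s \<omega> \<notin> B} \<subseteq> space M - ?G"
        proof safe
          fix \<omega> s assume \<omega>: "\<omega> \<in> space M" "s \<le> T" "X s \<omega> \<notin> B"
            "\<forall>t. d t \<omega> \<le> real K' + (l + \<epsilon>) * real t"
          have "real n \<le> d s \<omega>"
            using \<omega> X_in_V[of \<omega> s] by (auto simp: B_def graph_ball_def d_def graph_dist_commute)
          also have "\<dots> \<le> real K' + (l + \<epsilon>) * real s" using \<omega> by blast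
          \<comment> \<open>As \<open>l + \<epsilon>\<close> is nonnegative, the bound at
            \<open>T\<close> serves for all earlier times.\<close>
          also have "\<dots> \<le> real K' + (l + \<epsilon>) * real T" using \<omega> l by (auto intro!: mult_left_mono)
          finally show False using T by simp
        qed
      qed measurable
      also have "\<dots> = 1 - prob ?G" by (rule prob_compl) measurable
      finally show ?thesis using K' by simp
    qed
    moreover have "prob {\<omega>\<in>space M. X T \<omega> \<in> D} \<le> real k * ?b + p / 4"
    proof -
      let ?G = "{\<omega>\<in>space M. \<forall>t. f t \<omega> \<le> real K + (- h + \<epsilon>) * real t}"
      \<comment> \<open>On \<open>?G\<close> the walk is never at a vertex of probability above
        \<open>?b\<close> at time \<open>T\<close>, so only the part \<open>?D\<close> of
        \<open>D\<close> has to be counted.\<close>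
      let ?D = "{x\<in>D. srw_prob E T v0 x \<le> ?b}"
      have "{\<omega>\<in>space M. X T \<omega> \<in> D} \<subseteq> (\<Union>x\<in>?D. {\<omega>\<in>space M. X T \<omega> = x}) \<union> (space M - ?G)"
      proof safe
        fix \<omega> t assume \<omega>: "\<omega> \<in> space M" "X T \<omega> \<in> D" "\<omega> \<notin> (\<Union>x\<in>?D. {\<omega>\<in>space M. X T \<omega> = x})"
          and G: "\<forall>t. f t \<omega> \<le> real K + (- h + \<epsilon>) * real t"
        have "?b < srw_prob E T v0 (X T \<omega>)" using \<omega> by auto
        then have "ln ?b < ln (srw_prob E T v0 (X T \<omega>))"
          by (subst ln_less_cancel_iff) (auto intro: less_trans[OF exp_gt_zero])
        then have "real K - (h - \<epsilon>) * real T < f T \<omega>" by (simp add: f_def)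
        moreover have "f T \<omega> \<le> real K + (- h + \<epsilon>) * real T" using G by blast
        ultimately show False by (simp add: algebra_simps)
      qed
      then have "prob {\<omega>\<in>space M. X T \<omega> \<in> D} \<le>
          prob ((\<Union>x\<in>?D. {\<omega>\<in>space M. X T \<omega> = x}) \<union> (space M - ?G))"
        using D(2) by (intro finite_measure_mono sets.Un) auto
      also have "\<dots> \<le> prob (\<Union>x\<in>?D. {\<omega>\<in>space M. X T \<omega> = x}) + prob (space M - ?G)"
        using D(2) by (intro measure_Un_le) auto
      also have "prob (\<Union>x\<in>?D. {\<omega>\<in>space M. X T \<omega> = x}) \<le> (\<Sum>x\<in>?D. prob {\<omega>\<in>space M. X T \<omega> = x})"
        using D(2) by (intro finite_measure_subadditive_finite) auto
      also have "\<dots> \<le> (\<Sum>x\<in>?D. ?b)" by (intro sum_mono) (auto simp: prob_X)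
      also have "\<dots> \<le> real k * ?b"
      proof -
        have "card ?D \<le> card D" using D(2) by (intro card_mono) auto
        then show ?thesis using D(3) by (auto intro!: mult_right_mono)
      qed
      also have "prob (space M - ?G) = 1 - prob ?G" by (rule prob_compl) measurable
      finally show ?thesis using K by simp
    qed
    ultimately show ?thesis by simp
  qed
  then show ?thesis by blast
qed

end

section \<open>Exponential rate of the toppling number\<close>

theorem theorem6p6:
  fixes V :: "'a set" and E :: "'a \<Rightarrow> 'a \<Rightarrow> bool" and v0 :: 'a
    and M :: "'w measure" and X :: "nat \<Rightarrow> 'w \<Rightarrow> 'a"
    and l h p :: real
  assumes graph: "simple_graph V E" "infinite V" "connected_graph V E" "locally_finite_graph V E"
    and origin: "v0 \<in> V"
    and walk: "simple_random_walk V E v0 M X"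
    and speed: "AE \<omega> in M. (\<lambda>t. real (graph_dist E (X 0 \<omega>) (X t \<omega>)) / real t) \<longlonglongrightarrow> l"
    and speed_pos: "l > 0"
    and entropy: "(\<lambda>t. shannon_entropy M (X t) / real t) \<longlonglongrightarrow> h"
    and entropy_pos: "h > 0"
    and transition: "AE \<omega> in M. (\<lambda>t. ln (srw_prob E t v0 (X t \<omega>)) / real t) \<longlonglongrightarrow> - h"
    and p: "0 < p" "p < 1"
  shows "(\<exists>\<epsilon> :: nat \<Rightarrow> real. \<epsilon> \<longlonglongrightarrow> 0 \<and>
            (\<forall>\<^sub>F n in sequentially.
               ereal_of_enat (toppling_number V E p (graph_ball V E v0 n) (indicator {v0})) =
               ereal (exp (real n * (h / l) * (1 + \<epsilon> n)))))
       \<and> (\<lambda>n. ln (real (the_enat (toppling_number V E p (graph_ball V E v0 n) (indicator {v0}))))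
               / real n) \<longlonglongrightarrow> h / l"
proof -
  have "prob_space M" using walk by (auto simp: simple_random_walk_def)
  then interpret graph_walk V E M v0 X
    using graph origin walk
    by (auto intro!: graph_walk.intro infinite_graph.intro graph_walk_axioms.intro)
  define N where "N n = toppling_number V E p (graph_ball V E v0 n) (indicator {v0})" for n
  define L where "L n = ln (real (the_enat (N n)))" for n
  \<comment> \<open>The logarithm is controlled only for \<open>0 < k\<close>, and
    \<open>lower\<close> speaks only of finite values: this claim supplies finiteness,
    \<open>lower\<close> positivity, and \<open>finite\<close> joins them.\<close>
  have upper: "\<forall>\<^sub>F n in sequentially. \<exists>k. N n = enat k \<and> (0 < k \<longrightarrow> L n / real n < a)" if a: "h / l < a" for a
  proof -
    \<comment> \<open>This ratio is the rate that the upper bound gives with \<open>T\<close> about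
      \<open>n / (l - \<epsilon>)\<close>; a small \<open>\<epsilon>\<close> keeps it below
      \<open>a\<close>.\<close>
    have "((\<lambda>\<epsilon>. (h + \<epsilon>) / (l - \<epsilon>)) \<longlongrightarrow> (h + 0) / (l - 0)) (at_right 0)"
      using speed_pos by (intro tendsto_intros) auto
    then have "\<forall>\<^sub>F \<epsilon> in at_right 0. (h + \<epsilon>) / (l - \<epsilon>) < a"
      using a by (intro order_tendstoD) auto
    moreover have "\<forall>\<^sub>F \<epsilon> in at_right 0. \<epsilon> \<in> {0<..<l}"
      using speed_pos by (rule eventually_at_right_real)
    ultimately have "\<forall>\<^sub>F \<epsilon> in at_right 0. (h + \<epsilon>) / (l - \<epsilon>) < a \<and> \<epsilon> \<in> {0<..<l}"
      by (rule eventually_conj)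
    then obtain \<epsilon> where \<epsilon>: "(h + \<epsilon>) / (l - \<epsilon>) < a" "0 < \<epsilon>" "\<epsilon> < l"
      using eventually_happens'[OF trivial_limit_at_right_real] by force
    have "0 \<le> h + \<epsilon>" using \<epsilon>(2) entropy_pos by simp
    from toppling_number_upper[OF speed transition p(2) \<epsilon>(2) this] obtain K K' :: nat where
      KK: "\<And>n T. T > 0 \<Longrightarrow> real n + real K' \<le> (l - \<epsilon>) * real T \<Longrightarrow>
        (\<exists>k. N n \<le> enat k \<and> real k \<le> real T * exp (real K + (h + \<epsilon>) * real T))"
      unfolding N_def by blast
    define \<alpha> where "\<alpha> = 1 / (l - \<epsilon>)"
    \<comment> \<open>The 2 pays for the ceiling and the \<open>Suc\<close> in
      \<open>T\<close>.\<close>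
    define \<beta> where "\<beta> = real K' * \<alpha> + 2"
    define \<gamma> where "\<gamma> = h + \<epsilon>"
    have pos: "\<alpha> > 0" "\<gamma> > 0" "\<beta> > 0" using \<epsilon> entropy_pos by (auto simp: \<alpha>_def \<gamma>_def \<beta>_def add_nonneg_pos)
    have "(\<lambda>n. (ln (\<alpha> * real n + \<beta>) + real K + \<gamma> * (\<alpha> * real n + \<beta>)) / real n) \<longlonglongrightarrow> \<gamma> * \<alpha>"
      using pos by real_asymp
    then have "\<forall>\<^sub>F n in sequentially. (ln (\<alpha> * real n + \<beta>) + real K + \<gamma> * (\<alpha> * real n + \<beta>)) / real n < a"
      using \<epsilon> by (intro order_tendstoD) (auto simp: \<alpha>_def \<gamma>_def)
    then show ?thesis using eventually_gt_at_top[of 0]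
    proof eventually_elim
      case (elim n)
      \<comment> \<open>The \<open>Suc\<close> ensures \<open>T > 0\<close>, as the upper bound
        requires.\<close>
      define T where "T = Suc (nat \<lceil>(real n + real K') * \<alpha>\<rceil>)"
      have T: "(real n + real K') * \<alpha> \<le> real T" "real T \<le> \<alpha> * real n + \<beta>"
      proof -
        have "0 \<le> (real n + real K') * \<alpha>" using pos by simp
        then have "real T = of_int \<lceil>(real n + real K') * \<alpha>\<rceil> + 1" by (simp add: T_def)
        then show "(real n + real K') * \<alpha> \<le> real T" "real T \<le> \<alpha> * real n + \<beta>"
          unfolding \<beta>_def by (simp_all add: algebra_simps) linarith+
      qed
      have "real n + real K' \<le> (l - \<epsilon>) * real T" using T(1) \<epsilon> by (simp add: \<alpha>_def field_simps)
      then obtain k where k: "N n \<le> enat k" "real k \<le> real T * exp (real K + (h + \<epsilon>) * real T)"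
        using KK[of T n] by (auto simp: T_def)
      then obtain j where j: "N n = enat j" "j \<le> k" by (cases "N n") auto
      have "L n / real n < a" if "0 < j"
      proof -
        have "real j \<le> real T * exp (real K + \<gamma> * real T)" using j k by (simp add: \<gamma>_def)
        then have "L n \<le> ln (real T * exp (real K + \<gamma> * real T))"
          using that j(1) unfolding L_def by (subst ln_le_cancel_iff) (auto simp: T_def)
        also have "\<dots> = ln (real T) + (real K + \<gamma> * real T)"
          by (subst ln_mult) (auto simp: T_def)
        also have "\<dots> \<le> ln (\<alpha> * real n + \<beta>) + (real K + \<gamma> * (\<alpha> * real n + \<beta>))"
        proof -
          have "0 < real T" by (simp add: T_def)
          then show ?thesis using T(2) pos by (intro add_mono mult_left_mono) auto
        qed
        finally have "L n / real n \<le> (ln (\<alpha> * real n + \<beta>) + real K + \<gamma> * (\<alpha> * real n + \<beta>)) / real n"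
          by (intro divide_right_mono) auto
        then show ?thesis using elim by linarith
      qed
      then show ?case using j by blast
    qed
  qed
  have lower: "\<forall>\<^sub>F n in sequentially. \<forall>k. N n = enat k \<longrightarrow> 0 < k \<and> a < L n / real n" if a: "a < h / l" for a
  proof -
    have "((\<lambda>\<epsilon>. (h - \<epsilon>) / (l + \<epsilon>)) \<longlongrightarrow> (h - 0) / (l + 0)) (at_right 0)"
      using speed_pos by (intro tendsto_intros) auto
    then have "\<forall>\<^sub>F \<epsilon> in at_right 0. a < (h - \<epsilon>) / (l + \<epsilon>)"
      using a by (intro order_tendstoD) auto
    moreover have "\<forall>\<^sub>F \<epsilon> in at_right 0. \<epsilon> \<in> {0<..<h}"
      using entropy_pos by (rule eventually_at_right_real)
    ultimately have "\<forall>\<^sub>F \<epsilon> in at_right 0. a < (h - \<epsilon>) / (l + \<epsilon>) \<and> \<epsilon> \<in> {0<..<h}"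
      by (rule eventually_conj)
    then obtain \<epsilon> where \<epsilon>: "a < (h - \<epsilon>) / (l + \<epsilon>)" "0 < \<epsilon>" "\<epsilon> < h"
      using eventually_happens'[OF trivial_limit_at_right_real] by force
    have "0 \<le> l + \<epsilon>" using \<epsilon>(2) speed_pos by simp
    from toppling_number_lower[OF speed transition p(1) \<epsilon>(2) this] obtain K K' :: nat where
      KK: "\<And>n T k. real K' + (l + \<epsilon>) * real T < real n \<Longrightarrow> N n = enat k \<Longrightarrow>
        p / 2 \<le> real k * exp (real K - (h - \<epsilon>) * real T)"
      unfolding N_def by blast
    define \<alpha> where "\<alpha> = 1 / (l + \<epsilon>)"
    define \<beta> where "\<beta> = real K' * \<alpha> + 2"
    define \<gamma> where "\<gamma> = h - \<epsilon>"
    have pos: "\<alpha> > 0" "\<gamma> > 0" "\<beta> > 0"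
      using \<epsilon> speed_pos by (auto simp: \<alpha>_def \<gamma>_def \<beta>_def add_nonneg_pos)
    have "(\<lambda>n. (ln (p / 2) - real K + \<gamma> * (\<alpha> * real n - \<beta>)) / real n) \<longlonglongrightarrow> \<gamma> * \<alpha>"
      using pos by real_asymp
    then have "\<forall>\<^sub>F n in sequentially. a < (ln (p / 2) - real K + \<gamma> * (\<alpha> * real n - \<beta>)) / real n"
      using \<epsilon> by (intro order_tendstoD) (auto simp: \<alpha>_def \<gamma>_def)
    moreover have "\<forall>\<^sub>F n in sequentially. 0 < \<alpha> * real n - \<beta>"
      using pos by real_asymp
    ultimately show ?thesis using eventually_gt_at_top[of 0]
    proof eventually_elim
      case (elim n)
      \<comment> \<open>Subtracting 1 before rounding down gives the strict inequality required of
        \<open>T\<close>; both losses together are the 2 in \<open>\<beta>\<close>. The argument of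
        \<open>nat\<close> is nonnegative for the \<open>n\<close> considered.\<close>
      define T where "T = nat \<lfloor>(real n - real K') * \<alpha> - 1\<rfloor>"
      have T: "real T < (real n - real K') * \<alpha>" "\<alpha> * real n - \<beta> \<le> real T"
      proof -
        have "0 \<le> (real n - real K') * \<alpha> - 1" using elim by (simp add: \<beta>_def algebra_simps)
        then have "real T = of_int \<lfloor>(real n - real K') * \<alpha> - 1\<rfloor>" by (simp add: T_def)
        then show "real T < (real n - real K') * \<alpha>" "\<alpha> * real n - \<beta> \<le> real T"
          unfolding \<beta>_def by (simp_all add: algebra_simps) linarith+
      qed
      have Tn: "real K' + (l + \<epsilon>) * real T < real n" using T(1) \<epsilon> speed_pos by (simp add: \<alpha>_def field_simps)
      show ?case
      proof (intro allI impI)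
        fix k assume k: "N n = enat k"
        have le: "p / 2 \<le> real k * exp (real K - \<gamma> * real T)"
          using KK[OF Tn k] by (simp add: \<gamma>_def)
        \<comment> \<open>For \<open>k = 0\<close> the right side would vanish, while
          \<open>p / 2\<close> is positive.\<close>
        have k0: "0 < k" using le p by (cases k) auto
        have "ln (p / 2) \<le> ln (real k * exp (real K - \<gamma> * real T))"
          using le p k0 by (subst ln_le_cancel_iff) auto
        also have "\<dots> = L n + (real K - \<gamma> * real T)"
          using k0 k by (subst ln_mult) (auto simp: L_def)
        finally have "ln (p / 2) - real K + \<gamma> * real T \<le> L n" by simp
        moreover have "\<gamma> * (\<alpha> * real n - \<beta>) \<le> \<gamma> * real T" using T(2) pos by (intro mult_left_mono) auto
        ultimately have "(ln (p / 2) - real K + \<gamma> * (\<alpha> * real n - \<beta>)) / real n \<le> L n / real n"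
          by (intro divide_right_mono) auto
        then show "0 < k \<and> a < L n / real n" using elim k0 by linarith
      qed
    qed
  qed
  have finite: "\<forall>\<^sub>F n in sequentially. \<exists>k>0. N n = enat k"
  proof -
    have "h / l < h / l + 1" "h / l - 1 < h / l" by auto
    from upper[OF this(1)] lower[OF this(2)] show ?thesis by eventually_elim auto
  qed
  have lim: "(\<lambda>n. L n / real n) \<longlonglongrightarrow> h / l"
  proof (rule order_tendstoI)
    fix a assume "a < h / l"
    from lower[OF this] finite show "\<forall>\<^sub>F n in sequentially. a < L n / real n"
      by eventually_elim auto
  next
    fix a assume "h / l < a"
    from upper[OF this] finite show "\<forall>\<^sub>F n in sequentially. L n / real n < a"
      by eventually_elim auto
  qed
  \<comment> \<open>Obtained by solving \<open>L n = n * (h / l) * (1 + \<epsilon> n)\<close> for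
    the error term.\<close>
  define \<epsilon> where "\<epsilon> n = L n / real n / (h / l) - 1" for n
  have "\<epsilon> \<longlonglongrightarrow> h / l / (h / l) - 1"
    unfolding \<epsilon>_def
    by (rule tendsto_diff[OF tendsto_divide[OF lim tendsto_const] tendsto_const])
       (use entropy_pos speed_pos in auto)
  then have "\<epsilon> \<longlonglongrightarrow> 0" using entropy_pos speed_pos by simp
  moreover have "\<forall>\<^sub>F n in sequentially. ereal_of_enat (N n) = ereal (exp (real n * (h / l) * (1 + \<epsilon> n)))"
    using finite eventually_gt_at_top[of 0]
  proof eventually_elim
    case (elim n)
    then obtain k where k: "N n = enat k" "0 < k" by auto
    have "real n * (h / l) * (1 + \<epsilon> n) = L n"
      using elim entropy_pos speed_pos by (simp add: \<epsilon>_def)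
    then show ?case using k by (simp add: L_def)
  qed
  ultimately show ?thesis using lim unfolding N_def L_def by blast
qed

end
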